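(* Let $n,k\ge 1$, let $K\subseteq\mathbb{R}^n$ be a closed set that is a determining set of degree $k$, and let $y=(y_\alpha)_{\alpha\in\mathbb{Z}_+^n,\,|\alpha|\le k}$ be a truncated moment sequence of degree $k$ in $n$ variables. If the Riesz functional $L_y$ is strictly $K$-positive, then $y$ admits a $K$-representing measure.
   Context: $\mathbb{Z}_+$ is the set of nonnegative integers; for $\alpha\in\mathbb{Z}_+^n$, $|\alpha|=\alpha_1+\cdots+\alpha_n$ and $x^\alpha=x_1^{\alpha_1}\cdots x_n^{\alpha_n}$. A truncated moment sequence of degree $k$ in $n$ variables is any real family $y=(y_\alpha)_{|\alpha|\le k}$. $\mathcal{P}_k$ is the space of real polynomials in $x_1,\dots,x_n$ of degree at most $k$. The Riesz functional $L_y:\mathcal{P}_k\to\mathbb{R}$ is $L_y\big(\sum_{|\alpha|\le k}p_\alpha x^\alpha\big)=\sum_{|\alpha|\le k}p_\alpha y_\alpha$. $L_y$ is $K$-positive if $L_y(p)\ge 0$ for every $p\in\mathcal{P}_k$ with $p|_K\ge 0$; it is strictly $K$-positive if it is $K$-positive and moreover $L_y(p)>0$ for every $p\in\mathcal{P}_k$ with $p|_K\ge0$ and $p|_K\not\equiv 0$. $K$ is a determining set of degree $k$ if every $p\in\mathcal{P}_k$ with $p|_K\equiv 0$ is the zero polynomial. A $K$-representing measure for $y$ is a positive Borel measure $\mu$ on $\mathbb{R}^n$, supported in $K$, such that $y_\alpha=\int_{\mathbb{R}^n}x^\alpha\,d\mu(x)$ for all $|\alpha|\le k$. *)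

theory Defs
  imports "HOL-Analysis.Analysis" "HOL-Library.Poly_Mapping"
begin

text \<open>
  The variables are indexed by a finite type \<open>'n\<close>, so that points live in \<open>real ^ 'n\<close>.
  A multi-index is an element of \<open>'n \<Rightarrow>\<^sub>0 nat\<close>, and a real polynomial is a finitely supported
  coefficient family indexed by multi-indices, with the ring structure of \<^theory>\<open>HOL-Library.Poly_Mapping\<close>.
\<close>

type_synonym 'n multi_index = "'n \<Rightarrow>\<^sub>0 nat"

type_synonym 'n real_mpoly = "'n multi_index \<Rightarrow>\<^sub>0 real"

definition mi_deg :: "'n::finite multi_index \<Rightarrow> nat" where
  "mi_deg \<alpha> = (\<Sum>i\<in>UNIV. Poly_Mapping.lookup \<alpha> i)"

definition mi_power :: "real ^ 'n::finite \<Rightarrow> 'n multi_index \<Rightarrow> real" where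
  "mi_power x \<alpha> = (\<Prod>i\<in>UNIV. (x $ i) ^ Poly_Mapping.lookup \<alpha> i)"

definition mi_upto :: "nat \<Rightarrow> 'n::finite multi_index set" where
  "mi_upto k = {\<alpha>. mi_deg \<alpha> \<le> k}"

definition polys_upto :: "nat \<Rightarrow> 'n::finite real_mpoly set" where
  "polys_upto k = {p. Poly_Mapping.keys p \<subseteq> mi_upto k}"

definition mpoly_eval :: "'n::finite real_mpoly \<Rightarrow> real ^ 'n \<Rightarrow> real" where
  "mpoly_eval p x = (\<Sum>\<alpha>\<in>Poly_Mapping.keys p. Poly_Mapping.lookup p \<alpha> * mi_power x \<alpha>)"

text \<open>
  A truncated moment sequence of degree \<open>k\<close> is given by a total function \<open>y\<close> on multi-indices of
  which only the values on \<^term>\<open>mi_upto k\<close> are ever used; \<open>k\<close> is therefore passed explicitly.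
\<close>

definition riesz :: "nat \<Rightarrow> ('n::finite multi_index \<Rightarrow> real) \<Rightarrow> 'n real_mpoly \<Rightarrow> real" where
  "riesz k y p = (\<Sum>\<alpha>\<in>mi_upto k. Poly_Mapping.lookup p \<alpha> * y \<alpha>)"

definition K_positive ::
  "nat \<Rightarrow> (real ^ 'n::finite) set \<Rightarrow> ('n multi_index \<Rightarrow> real) \<Rightarrow> bool" where
  "K_positive k K y \<longleftrightarrow>
     (\<forall>p\<in>polys_upto k. (\<forall>x\<in>K. mpoly_eval p x \<ge> 0) \<longrightarrow> riesz k y p \<ge> 0)"

definition strictly_K_positive ::
  "nat \<Rightarrow> (real ^ 'n::finite) set \<Rightarrow> ('n multi_index \<Rightarrow> real) \<Rightarrow> bool" where
  "strictly_K_positive k K y \<longleftrightarrow>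
     K_positive k K y \<and>
     (\<forall>p\<in>polys_upto k. (\<forall>x\<in>K. mpoly_eval p x \<ge> 0) \<and> \<not> (\<forall>x\<in>K. mpoly_eval p x = 0)
        \<longrightarrow> riesz k y p > 0)"

definition determining_set :: "nat \<Rightarrow> (real ^ 'n::finite) set \<Rightarrow> bool" where
  "determining_set k K \<longleftrightarrow>
     (\<forall>p\<in>polys_upto k. (\<forall>x\<in>K. mpoly_eval p x = 0) \<longrightarrow> p = 0)"

text \<open>
  ``Supported in \<open>K\<close>'' means that the complement of \<open>K\<close> is a null set. The integrability condition
  is needed because \<^const>\<open>lebesgue_integral\<close> is \<open>0\<close> on non-integrable functions; at \<open>\<alpha> = 0\<close> it
  makes \<open>\<mu>\<close> finite.
\<close>

definition K_representing_measure ::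
  "nat \<Rightarrow> (real ^ 'n::finite) set \<Rightarrow> ('n multi_index \<Rightarrow> real) \<Rightarrow> (real ^ 'n) measure \<Rightarrow> bool" where
  "K_representing_measure k K y \<mu> \<longleftrightarrow>
     sets \<mu> = sets borel \<and>
     emeasure \<mu> (UNIV - K) = 0 \<and>
     (\<forall>\<alpha>\<in>mi_upto k. integrable \<mu> (\<lambda>x. mi_power x \<alpha>) \<and> y \<alpha> = (\<integral>x. mi_power x \<alpha> \<partial>\<mu>))"

text \<open>The sum in \<^const>\<open>riesz\<close> ranges over a finite set.\<close>

lemma finite_mi_upto: "finite (mi_upto k :: 'n::finite multi_index set)"
proof -
  have "Poly_Mapping.lookup \<alpha> i \<le> k" if "\<alpha> \<in> mi_upto k" for \<alpha> :: "'n multi_index" and i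
  proof -
    have "Poly_Mapping.lookup \<alpha> i \<le> mi_deg \<alpha>"
      unfolding mi_deg_def by (rule member_le_sum) auto
    with that show ?thesis
      by (simp add: mi_upto_def)
  qed
  then have "Poly_Mapping.lookup ` (mi_upto k :: 'n multi_index set) \<subseteq> (UNIV \<rightarrow>\<^sub>E {..k})"
    by (auto simp: PiE_UNIV_domain)
  then have "finite (Poly_Mapping.lookup ` (mi_upto k :: 'n multi_index set))"
    by (rule finite_subset) (intro finite_PiE finite finite_atMost)
  then show ?thesis
    by (rule finite_imageD) (meson inj_onI poly_mapping.lookup_inject)
qed

end

theory Submission
  imports Defs
begin

text \<open>
  The representing measure found here is finitely atomic. The moment sequences of finite positive
  combinations of point masses in \<open>K\<close> form a convex cone in the finite-dimensional space of
  families indexed by \<^term>\<open>mi_upto k\<close>. If \<open>y\<close> were outside this cone, a nonzero linear functional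
  would be nonnegative on the cone and nonpositive at \<open>y\<close>. Such a functional is a nonzero
  polynomial \<open>p\<close> of degree at most \<open>k\<close>; evaluated at the moments of a point mass it gives the value of
  \<open>p\<close> there, so \<open>p\<close> is nonnegative on \<open>K\<close>, while its Riesz value is at most \<open>0\<close>. As \<open>K\<close> is
  determining, \<open>p\<close> does not vanish identically on \<open>K\<close>, and this contradicts strict positivity
  (\<open>moments_of_point_masses\<close>). Since the cone need not be closed, the separation is only weak;
  strict positivity makes up for this.

  The dimension of the space depends on \<open>k\<close>, so it is not the dimension of one Euclidean type.
  The separation theorem (\<open>cone_separation\<close>) is therefore proved for cones of real functions
  compared on a finite index set, by induction on the number of coordinates.
\<close>

section \<open>Separation for cones of functions on a finite index set\<close>

definition function_cone :: "('i \<Rightarrow> real) set \<Rightarrow> bool" where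
  "function_cone D \<longleftrightarrow>
     (\<forall>d\<in>D. \<forall>e\<in>D. (\<lambda>i. d i + e i) \<in> D) \<and> (\<forall>t>0. \<forall>d\<in>D. (\<lambda>i. t * d i) \<in> D)"

text \<open>
  The separation property is given a name since the induction uses it for two different smaller
  index sets.
\<close>

definition separates_cones :: "'i set \<Rightarrow> bool" where
  "separates_cones I \<longleftrightarrow>
     (\<forall>D. function_cone D \<longrightarrow> (\<forall>d\<in>D. \<exists>i\<in>I. d i \<noteq> 0) \<longrightarrow>
        (\<exists>a. (\<exists>i\<in>I. a i \<noteq> 0) \<and> (\<forall>d\<in>D. 0 \<le> (\<Sum>i\<in>I. a i * d i))))"

lemma function_cone_add: "function_cone D \<Longrightarrow> d \<in> D \<Longrightarrow> e \<in> D \<Longrightarrow> (\<lambda>i. d i + e i) \<in> D"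
  and function_cone_scale: "function_cone D \<Longrightarrow> d \<in> D \<Longrightarrow> t > 0 \<Longrightarrow> (\<lambda>i. t * d i) \<in> D"
  by (auto simp: function_cone_def)

lemma nonneg_if_all_small:
  fixes b c :: real
  assumes "\<And>t. t > 0 \<Longrightarrow> 0 \<le> c + t * b"
  shows "0 \<le> c"
proof (rule ccontr)
  assume c: "\<not> 0 \<le> c"
  define t where "t = - c / (2 * (\<bar>b\<bar> + 1))"
  have t: "t > 0" using c by (simp add: t_def field_simps)
  have "t * b \<le> t * (\<bar>b\<bar> + 1)" using t by (intro mult_left_mono) auto
  also have "\<dots> = - c / 2" by (simp add: t_def field_simps)
  finally show False using assms[OF t] c by linarith
qed

text \<open>
  Separating a point \<open>w\<close> from a cone \<open>C\<close> amounts to separating the origin from the cone of all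
  \<open>z - t w\<close> with \<open>t > 0\<close>, which avoids the origin because \<open>z = t w\<close> would put \<open>w\<close> into \<open>C\<close>.
  Letting \<open>t\<close> tend to \<open>0\<close> recovers the inequality on \<open>C\<close> itself.
\<close>

lemma separate_point_from_cone:
  assumes sep: "separates_cones I"
    and C: "function_cone C" and zero: "(\<lambda>_. 0) \<in> C"
    and w: "\<And>z. z \<in> C \<Longrightarrow> \<exists>i\<in>I. z i \<noteq> w i"
  shows "\<exists>a. (\<exists>i\<in>I. a i \<noteq> 0) \<and> (\<forall>z\<in>C. 0 \<le> (\<Sum>i\<in>I. a i * z i)) \<and> (\<Sum>i\<in>I. a i * w i) \<le> 0"
proof -
  define E where "E = {\<lambda>i. z i - t * w i | z t. z \<in> C \<and> t > 0}"
  have "function_cone E"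
    unfolding function_cone_def
  proof (intro conjI ballI allI impI)
    fix d e assume "d \<in> E" "e \<in> E"
    then obtain z t z' t' where *: "d = (\<lambda>i. z i - t * w i)" "z \<in> C" "t > 0"
        "e = (\<lambda>i. z' i - t' * w i)" "z' \<in> C" "t' > 0"
      unfolding E_def by blast
    have "(\<lambda>i. d i + e i) = (\<lambda>i. (z i + z' i) - (t + t') * w i)"
      using * by (auto simp: algebra_simps)
    then show "(\<lambda>i. d i + e i) \<in> E"
      unfolding E_def using * function_cone_add[OF C, of z z']
      by (intro CollectI exI[of _ "\<lambda>i. z i + z' i"] exI[of _ "t + t'"]) auto
  next
    fix s :: real and d assume "s > 0" "d \<in> E"
    then obtain z t where *: "d = (\<lambda>i. z i - t * w i)" "z \<in> C" "t > 0"
      unfolding E_def by blast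
    have "(\<lambda>i. s * d i) = (\<lambda>i. s * z i - (s * t) * w i)"
      using * by (auto simp: algebra_simps)
    then show "(\<lambda>i. s * d i) \<in> E"
      unfolding E_def using * \<open>s > 0\<close> function_cone_scale[OF C, of z s]
      by (intro CollectI exI[of _ "\<lambda>i. s * z i"] exI[of _ "s * t"]) auto
  qed
  moreover have "\<exists>i\<in>I. d i \<noteq> 0" if "d \<in> E" for d
  proof -
    from that obtain z t where *: "d = (\<lambda>i. z i - t * w i)" "z \<in> C" "t > 0"
      unfolding E_def by blast
    obtain i where "i \<in> I" "inverse t * z i \<noteq> w i"
      using w[OF function_cone_scale[OF C \<open>z \<in> C\<close>, of "inverse t"]] \<open>t > 0\<close> by auto
    then show ?thesis using * by (intro bexI[of _ i]) (auto simp: field_simps)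
  qed
  ultimately obtain a where a: "\<exists>i\<in>I. a i \<noteq> 0" and aE: "\<forall>d\<in>E. 0 \<le> (\<Sum>i\<in>I. a i * d i)"
    using sep unfolding separates_cones_def by blast
  have split: "0 \<le> (\<Sum>i\<in>I. a i * z i) + t * (- (\<Sum>i\<in>I. a i * w i))" if "z \<in> C" "t > 0" for z t
  proof -
    have "(\<lambda>i. z i - t * w i) \<in> E" unfolding E_def using that by blast
    then have "0 \<le> (\<Sum>i\<in>I. a i * (z i - t * w i))" by (rule bspec[OF aE])
    also have "\<dots> = (\<Sum>i\<in>I. a i * z i) + t * (- (\<Sum>i\<in>I. a i * w i))"
      by (simp add: algebra_simps sum_subtractf sum_distrib_left)
    finally show ?thesis .
  qed
  have "0 \<le> (\<Sum>i\<in>I. a i * z i)" if "z \<in> C" for z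
    by (rule nonneg_if_all_small) (rule split[OF that])
  moreover have "(\<Sum>i\<in>I. a i * w i) \<le> 0"
    using split[OF zero, of 1] by simp
  ultimately show ?thesis using a by blast
qed

lemma separates_cones_singleton: "separates_cones {j}"
  unfolding separates_cones_def
proof (intro allI impI)
  fix D :: "('a \<Rightarrow> real) set"
  assume D: "function_cone D" and nz: "\<forall>d\<in>D. \<exists>i\<in>{j}. d i \<noteq> 0"
  have "\<not> (d j > 0 \<and> e j < 0)" if "d \<in> D" "e \<in> D" for d e
  proof
    assume s: "d j > 0 \<and> e j < 0"
    have "(\<lambda>i. (- e j) * d i + d j * e i) \<in> D"
      using that s
        function_cone_add[OF D function_cone_scale[OF D, of d "- e j"] function_cone_scale[OF D, of e "d j"]]
      by auto
    then show False using nz by (auto simp: algebra_simps)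
  qed
  then consider "\<forall>d\<in>D. 0 \<le> d j" | "\<forall>d\<in>D. d j \<le> 0"
    using nz by (metis linorder_not_le)
  then show "\<exists>a. (\<exists>i\<in>{j}. a i \<noteq> 0) \<and> (\<forall>d\<in>D. 0 \<le> (\<Sum>i\<in>{j}. a i * d i))"
  proof cases
    case 1 then show ?thesis by (intro exI[of _ "\<lambda>_. 1"]) auto
  next
    case 2 then show ?thesis by (intro exI[of _ "\<lambda>_. -1"]) auto
  qed
qed

text \<open>
  Here the cone projects onto all functions on \<open>I - {j}\<close> and thus contains a vector \<open>u\<close> on the
  \<open>j\<close>-axis; measure height over \<open>I - {j}\<close> in units of \<open>u\<close>. The heights above the unit vector at \<open>i\<close>
  have an infimum \<open>c\<close>. Raising the cone by all positive multiples of \<open>u\<close> makes it miss the line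
  through the origin and the point of height \<open>c\<close> above this unit vector, so it can be projected along that line to
  lose the coordinate \<open>i\<close>; without raising, the infimum might be attained and the image might contain
  the origin.
\<close>

lemma separate_cone_with_axis_vector:
  fixes D :: "('i \<Rightarrow> real) set"
  assumes I: "finite I" "i \<in> I" "j \<in> I" "i \<noteq> j"
    and sep: "separates_cones (I - {i})"
    and D: "function_cone D"
    and nz: "\<And>d. d \<in> D \<Longrightarrow> \<exists>l\<in>I. d l \<noteq> 0"
    and onto: "\<And>w. \<exists>l\<in>I - {j}. w l \<noteq> 0 \<Longrightarrow> \<exists>d\<in>D. \<forall>l\<in>I - {j}. d l = w l"
  shows "\<exists>a. (\<exists>l\<in>I. a l \<noteq> 0) \<and> (\<forall>d\<in>D. 0 \<le> (\<Sum>l\<in>I. a l * d l))"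
proof -
  define J where "J = I - {j}"
  define unit where "unit = (\<lambda>l. if l = i then 1 else (0::real))"
  have iJ: "i \<in> J" using I by (simp add: J_def)
  have unit_ne: "\<exists>l\<in>J. unit l \<noteq> 0" "\<exists>l\<in>J. - unit l \<noteq> 0"
    using iJ by (auto simp: unit_def intro!: bexI[of _ i])
  obtain p where p: "p \<in> D" "\<forall>l\<in>J. p l = unit l"
    using onto[of unit] unit_ne(1) unfolding J_def by blast
  obtain q where q: "q \<in> D" "\<forall>l\<in>J. q l = - unit l"
    using onto[of "\<lambda>l. - unit l"] unit_ne(2) unfolding J_def by blast
  define u where "u = (\<lambda>l. p l + q l)"
  have uD: "u \<in> D" unfolding u_def using function_cone_add[OF D] p q by blast
  have uJ: "u l = 0" if "l \<in> J" for l using p q that by (simp add: u_def)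
  have uj: "u j \<noteq> 0" using nz[OF uD] uJ by (auto simp: J_def)
  define g where "g d = d j / u j" for d :: "'i \<Rightarrow> real"
  have pos: "g d > 0" if "d \<in> D" "\<forall>l\<in>J. d l = 0" for d
  proof (rule ccontr)
    assume "\<not> g d > 0"
    then consider "g d = 0" | "g d < 0" by linarith
    then show False
    proof cases
      case 1
      then show False using nz[OF that(1)] that(2) uj by (auto simp: g_def J_def)
    next
      case 2
      have "(\<lambda>l. d l + (- g d) * u l) \<in> D"
        using function_cone_add[OF D that(1) function_cone_scale[OF D uD, of "- g d"]] 2 by simp
      then obtain l where l: "l \<in> I" "d l + (- g d) * u l \<noteq> 0" using nz by blast
      show False
        by (cases "l = j") (use l that(2) uJ uj in \<open>auto simp: g_def J_def\<close>)
    qed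
  qed
  define S where "S = {g d | d. d \<in> D \<and> (\<forall>l\<in>J. d l = unit l)}"
  define c where "c = Inf S"
  have S_ne: "S \<noteq> {}" unfolding S_def using p by blast
  have above: "- g e < s" if "s \<in> S" "e \<in> D" "\<forall>l\<in>J. e l = - unit l" for s e
  proof -
    from that obtain d where d: "s = g d" "d \<in> D" "\<forall>l\<in>J. d l = unit l"
      unfolding S_def by blast
    have "0 < g (\<lambda>l. d l + e l)"
      by (rule pos) (use function_cone_add[OF D] d that in auto)
    then show ?thesis using d by (simp add: g_def add_divide_distrib)
  qed
  have bdd: "bdd_below S"
    by (rule bdd_belowI[of _ "- g q"]) (use above[OF _ q] in force)
  define E where "E = {d(j := g d + s - c * d i) | d s. d \<in> D \<and> s > 0}"
  have "function_cone E"
    unfolding function_cone_def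
  proof (intro conjI ballI allI impI)
    fix x y assume "x \<in> E" "y \<in> E"
    then obtain d s d' s' where *: "x = d(j := g d + s - c * d i)" "d \<in> D" "s > 0"
        "y = d'(j := g d' + s' - c * d' i)" "d' \<in> D" "s' > 0"
      unfolding E_def by blast
    let ?d = "\<lambda>l. d l + d' l"
    have "(\<lambda>l. x l + y l) = ?d(j := g ?d + (s + s') - c * ?d i)"
      using * by (auto simp: algebra_simps g_def add_divide_distrib)
    then show "(\<lambda>l. x l + y l) \<in> E"
      unfolding E_def using * function_cone_add[OF D, of d d']
      by (intro CollectI exI[of _ ?d] exI[of _ "s + s'"]) auto
  next
    fix t :: real and x assume t: "t > 0" and "x \<in> E"
    then obtain d s where *: "x = d(j := g d + s - c * d i)" "d \<in> D" "s > 0"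
      unfolding E_def by blast
    let ?d = "\<lambda>l. t * d l"
    have "(\<lambda>l. t * x l) = ?d(j := g ?d + (t * s) - c * ?d i)"
      using * by (auto simp: algebra_simps g_def)
    then show "(\<lambda>l. t * x l) \<in> E"
      unfolding E_def using * t function_cone_scale[OF D, of d t]
      by (intro CollectI exI[of _ ?d] exI[of _ "t * s"]) auto
  qed
  moreover have "\<exists>l\<in>I - {i}. x l \<noteq> 0" if "x \<in> E" for x
  proof (rule ccontr)
    assume "\<not> ?thesis"
    then have x0: "x l = 0" if "l \<in> I" "l \<noteq> i" for l using that by blast
    from \<open>x \<in> E\<close> obtain d s where x: "x = d(j := g d + s - c * d i)" and d: "d \<in> D" and s: "s > 0"
      unfolding E_def by blast
    have height: "g d + s = c * d i" using x0[of j] I x by simp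
    have dJ: "d l = d i * unit l" if "l \<in> J" for l
      using x0[of l] that x by (auto simp: J_def unit_def)
    consider "d i = 0" | "d i > 0" | "d i < 0" by linarith
    then show False
    proof cases
      case 1
      then show False using pos[OF d] dJ height s by auto
    next
      case 2
      let ?e = "\<lambda>l. inverse (d i) * d l"
      have "?e \<in> D" using function_cone_scale[OF D d] 2 by simp
      then have "g ?e \<in> S" unfolding S_def using dJ 2 by (auto simp: field_simps)
      then have "c \<le> g ?e" unfolding c_def using bdd by (rule cInf_lower)
      moreover have "g ?e = g d / d i" using 2 by (simp add: g_def field_simps)
      ultimately have "c * d i \<le> g d" using 2 by (simp add: pos_le_divide_eq)
      then show False using height s by linarith
    next
      case 3
      let ?e = "\<lambda>l. inverse (- d i) * d l"
      have eD: "?e \<in> D" using function_cone_scale[OF D d, of "inverse (- d i)"] 3 by simp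
      have eJ: "\<forall>l\<in>J. ?e l = - unit l" using dJ 3 by (auto simp: field_simps)
      have "- g ?e \<le> c" unfolding c_def
        by (rule cInf_greatest[OF S_ne]) (use above[OF _ eD eJ] in force)
      moreover have "g ?e = g d / (- d i)" using 3 by (simp add: g_def field_simps)
      ultimately have "g d / d i \<le> c" by simp
      then have "c * d i \<le> g d" using 3 by (simp add: neg_divide_le_eq)
      then show False using height s by linarith
    qed
  qed
  ultimately obtain a where a: "\<exists>l\<in>I - {i}. a l \<noteq> 0"
      and aE: "\<forall>x\<in>E. 0 \<le> (\<Sum>l\<in>I - {i}. a l * x l)"
    using sep unfolding separates_cones_def by blast
  \<comment> \<open>The functional on \<open>I - {i}\<close> is pulled back along the projection.\<close>
  define b where "b = a(j := a j / u j, i := - c * a j)"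
  have rest: "(\<Sum>l\<in>I. f l) = f i + (f j + (\<Sum>l\<in>I - {i} - {j}. f l))" for f :: "'i \<Rightarrow> real"
    using I by (simp add: sum.remove[of I i] sum.remove[of "I - {i}" j])
  have "0 \<le> (\<Sum>l\<in>I. b l * d l)" if d: "d \<in> D" for d
  proof (rule nonneg_if_all_small)
    fix s :: real assume "s > 0"
    let ?x = "d(j := g d + s - c * d i)"
    have "?x \<in> E" unfolding E_def using d \<open>s > 0\<close> by blast
    then have "0 \<le> (\<Sum>l\<in>I - {i}. a l * ?x l)" using aE by blast
    also have "\<dots> = a j * (g d + s - c * d i) + (\<Sum>l\<in>I - {i} - {j}. a l * ?x l)"
      using I by (simp add: sum.remove[of "I - {i}" j])
    also have "(\<Sum>l\<in>I - {i} - {j}. a l * ?x l) = (\<Sum>l\<in>I - {i} - {j}. b l * d l)"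
      by (rule sum.cong) (auto simp: b_def)
    also have "a j * (g d + s - c * d i) + \<dots> = (\<Sum>l\<in>I. b l * d l) + s * a j"
      unfolding rest[of "\<lambda>l. b l * d l"] using I uj by (simp add: b_def g_def algebra_simps)
    finally show "0 \<le> (\<Sum>l\<in>I. b l * d l) + s * a j" .
  qed
  moreover have "\<exists>l\<in>I. b l \<noteq> 0"
    using a uj by (auto simp: b_def)
  ultimately show ?thesis by blast
qed

text \<open>
  If the projection of \<open>D\<close> to \<open>I - {j}\<close> misses some nonzero \<open>w\<close>, then \<open>w\<close> can be separated from
  it by a functional independent of the coordinate \<open>j\<close>. Otherwise the projection is onto.
\<close>

theorem cone_separation:
  assumes "finite I" "I \<noteq> {}"
  shows "separates_cones I"
  using assms
proof (induction "card I" arbitrary: I rule: less_induct)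
  case less
  from \<open>I \<noteq> {}\<close> obtain j where j: "j \<in> I" by blast
  show ?case
  proof (cases "I = {j}")
    case True
    then show ?thesis by (simp add: separates_cones_singleton)
  next
    case False
    then obtain i where i: "i \<in> I" "i \<noteq> j" using j by blast
    have IH: "separates_cones (I - {l})" if "l \<in> I" for l
      using less.hyps[of "I - {l}"] less.prems i j that card_Diff1_less[of I l] by auto
    show ?thesis
      unfolding separates_cones_def
    proof (intro allI impI)
      fix D :: "('a \<Rightarrow> real) set"
      assume D: "function_cone D" and nz: "\<forall>d\<in>D. \<exists>i\<in>I. d i \<noteq> 0"
      show "\<exists>a. (\<exists>i\<in>I. a i \<noteq> 0) \<and> (\<forall>d\<in>D. 0 \<le> (\<Sum>i\<in>I. a i * d i))"
      proof (cases "\<forall>w. (\<exists>l\<in>I - {j}. w l \<noteq> 0) \<longrightarrow> (\<exists>d\<in>D. \<forall>l\<in>I - {j}. d l = w l)")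
        case True
        then show ?thesis
          using separate_cone_with_axis_vector[OF \<open>finite I\<close> i(1) j i(2) IH[OF i(1)] D] nz by blast
      next
        case False
        then obtain w where w: "\<exists>l\<in>I - {j}. w l \<noteq> 0" "\<forall>d\<in>D. \<exists>l\<in>I - {j}. d l \<noteq> w l"
          by blast
        have "function_cone (insert (\<lambda>_. 0) D)"
          using D by (auto simp: function_cone_def)
        moreover have "\<exists>l\<in>I - {j}. z l \<noteq> w l" if "z \<in> insert (\<lambda>_. 0) D" for z
          using w that by force
        ultimately obtain a where a: "\<exists>l\<in>I - {j}. a l \<noteq> 0"
            "\<forall>z\<in>insert (\<lambda>_. 0) D. 0 \<le> (\<Sum>l\<in>I - {j}. a l * z l)"
          using separate_point_from_cone[OF IH[OF j], of "insert (\<lambda>_. 0) D" w] by blast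
        have "(\<Sum>l\<in>I. (a(j := 0)) l * d l) = (\<Sum>l\<in>I - {j}. a l * d l)" for d
          using j \<open>finite I\<close> by (simp add: sum.remove[of I j])
        then show ?thesis using a by (intro exI[of _ "a(j := 0)"]) auto
      qed
    qed
  qed
qed

section \<open>Moments of finitely many point masses\<close>

definition point_moments :: "(real ^ 'n::finite) set \<Rightarrow> ('n multi_index \<Rightarrow> real) set" where
  "point_moments K = {\<lambda>\<alpha>. \<Sum>x\<in>F. c x * mi_power x \<alpha> | F c.
     finite F \<and> F \<subseteq> K \<and> (\<forall>x. 0 \<le> c x) \<and> (\<forall>x. x \<notin> F \<longrightarrow> c x = 0)}"

lemma function_cone_point_moments: "function_cone (point_moments K)"
  unfolding function_cone_def
proof (intro conjI ballI allI impI)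
  fix d e assume "d \<in> point_moments K" "e \<in> point_moments K"
  then obtain F c G b where
    d: "d = (\<lambda>\<alpha>. \<Sum>x\<in>F. c x * mi_power x \<alpha>)" "finite F" "F \<subseteq> K" "\<forall>x. 0 \<le> c x" "\<forall>x. x \<notin> F \<longrightarrow> c x = 0" and
    e: "e = (\<lambda>\<alpha>. \<Sum>x\<in>G. b x * mi_power x \<alpha>)" "finite G" "G \<subseteq> K" "\<forall>x. 0 \<le> b x" "\<forall>x. x \<notin> G \<longrightarrow> b x = 0"
    unfolding point_moments_def by blast
  have "d = (\<lambda>\<alpha>. \<Sum>x\<in>F \<union> G. c x * mi_power x \<alpha>)"
    unfolding d(1) by (rule ext, rule sum.mono_neutral_left) (use d e in auto)
  moreover have "e = (\<lambda>\<alpha>. \<Sum>x\<in>F \<union> G. b x * mi_power x \<alpha>)"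
    unfolding e(1) by (rule ext, rule sum.mono_neutral_left) (use d e in auto)
  ultimately have "(\<lambda>\<alpha>. d \<alpha> + e \<alpha>) = (\<lambda>\<alpha>. \<Sum>x\<in>F \<union> G. (c x + b x) * mi_power x \<alpha>)"
    by (simp add: sum.distrib distrib_right)
  then show "(\<lambda>\<alpha>. d \<alpha> + e \<alpha>) \<in> point_moments K"
    unfolding point_moments_def using d e
    by (intro CollectI exI[of _ "F \<union> G"] exI[of _ "\<lambda>x. c x + b x"]) auto
next
  fix t :: real and d assume t: "t > 0" and "d \<in> point_moments K"
  then obtain F c where
    d: "d = (\<lambda>\<alpha>. \<Sum>x\<in>F. c x * mi_power x \<alpha>)" "finite F" "F \<subseteq> K" "\<forall>x. 0 \<le> c x" "\<forall>x. x \<notin> F \<longrightarrow> c x = 0"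
    unfolding point_moments_def by blast
  have "(\<lambda>\<alpha>. t * d \<alpha>) = (\<lambda>\<alpha>. \<Sum>x\<in>F. (t * c x) * mi_power x \<alpha>)"
    by (simp add: d(1) sum_distrib_left mult.assoc)
  then show "(\<lambda>\<alpha>. t * d \<alpha>) \<in> point_moments K"
    unfolding point_moments_def using d t
    by (intro CollectI exI[of _ F] exI[of _ "\<lambda>x. t * c x"]) auto
qed

lemma zero_in_point_moments: "(\<lambda>_. 0) \<in> point_moments K"
  unfolding point_moments_def by (intro CollectI exI[of _ "{}"] exI[of _ "\<lambda>_. 0"]) auto

lemma mi_power_in_point_moments: "x \<in> K \<Longrightarrow> mi_power x \<in> point_moments K"
  unfolding point_moments_def
  by (intro CollectI exI[of _ "{x}"] exI[of _ "\<lambda>z. if z = x then 1 else 0"]) auto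

lemma K_representing_measure_point_masses:
  fixes K :: "(real ^ 'n::finite) set"
  assumes "z \<in> point_moments K" and y: "\<And>\<alpha>. \<alpha> \<in> mi_upto k \<Longrightarrow> y \<alpha> = z \<alpha>"
  shows "\<exists>\<mu>. K_representing_measure k K y \<mu>"
proof -
  obtain F c where F: "finite F" "F \<subseteq> K" and c: "\<forall>x. 0 \<le> c x"
      and z: "z = (\<lambda>\<alpha>. \<Sum>x\<in>F. c x * mi_power x \<alpha>)"
    using assms(1) unfolding point_moments_def by blast
  define P where "P = point_measure F (\<lambda>x. ennreal (c x))"
  \<comment> \<open>The image under the identity turns a measure on the subsets of \<open>F\<close> into a Borel measure.\<close>
  define \<mu> where "\<mu> = distr P borel (\<lambda>x. x)"
  have id: "(\<lambda>x. x) \<in> measurable P borel"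
    by (simp add: P_def measurable_point_measure_eq1)
  have mp: "(\<lambda>x. mi_power x \<alpha>) \<in> borel_measurable borel" for \<alpha> :: "'n multi_index"
    unfolding mi_power_def
    by (intro borel_measurable_continuous_onI continuous_intros)
  have "integrable \<mu> (\<lambda>x. mi_power x \<alpha>) \<and> y \<alpha> = (\<integral>x. mi_power x \<alpha> \<partial>\<mu>)"
    if "\<alpha> \<in> mi_upto k" for \<alpha>
    unfolding \<mu>_def integrable_distr_eq[OF id mp] integral_distr[OF id mp] y[OF that] z
    using F c
    by (simp add: P_def integrable_point_measure_finite lebesgue_integral_point_measure_finite)
  moreover have "emeasure \<mu> (UNIV - K) = 0"
  proof (cases "UNIV - K \<in> sets borel")
    case True
    have "(\<lambda>x. x) -` (UNIV - K) \<inter> space P = {}"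
      using F by (auto simp: P_def space_point_measure)
    then show ?thesis by (simp only: \<mu>_def emeasure_distr[OF id True] emeasure_empty)
  next
    case False
    \<comment> \<open>The measure of a set outside the sigma-algebra is \<open>0\<close> by convention.\<close>
    then show ?thesis by (simp add: \<mu>_def emeasure_notin_sets)
  qed
  ultimately show ?thesis
    unfolding K_representing_measure_def by (intro exI[of _ \<mu>]) (auto simp: \<mu>_def)
qed

section \<open>Strictly positive functionals\<close>

text \<open>Linear functionals on families indexed by \<^term>\<open>mi_upto k\<close> are polynomials of degree at most \<open>k\<close>.\<close>

lemma polynomial_with_coefficients:
  fixes a :: "'n::finite multi_index \<Rightarrow> real"
  obtains p where "p \<in> polys_upto k"
    and "\<And>\<alpha>. \<alpha> \<in> mi_upto k \<Longrightarrow> Poly_Mapping.lookup p \<alpha> = a \<alpha>"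
    and "\<And>x. mpoly_eval p x = (\<Sum>\<alpha>\<in>mi_upto k. a \<alpha> * mi_power x \<alpha>)"
    and "\<And>y. riesz k y p = (\<Sum>\<alpha>\<in>mi_upto k. a \<alpha> * y \<alpha>)"
proof -
  define f where "f = (\<lambda>\<alpha>. if \<alpha> \<in> mi_upto k then a \<alpha> else 0)"
  define p where "p = Abs_poly_mapping f"
  have "finite {\<alpha>. f \<alpha> \<noteq> 0}"
    by (rule finite_subset[OF _ finite_mi_upto[of k]]) (auto simp: f_def)
  then have lookup: "Poly_Mapping.lookup p = f"
    by (simp add: p_def Abs_poly_mapping_inverse)
  have keys: "Poly_Mapping.keys p \<subseteq> mi_upto k"
    by (auto simp: keys.rep_eq lookup f_def split: if_splits)
  have "mpoly_eval p x = (\<Sum>\<alpha>\<in>mi_upto k. a \<alpha> * mi_power x \<alpha>)" for x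
  proof -
    have "mpoly_eval p x = (\<Sum>\<alpha>\<in>mi_upto k. Poly_Mapping.lookup p \<alpha> * mi_power x \<alpha>)"
      unfolding mpoly_eval_def
      by (rule sum.mono_neutral_left) (use keys finite_mi_upto in_keys_iff in fastforce)+
    then show ?thesis by (simp add: lookup f_def)
  qed
  moreover have "riesz k y p = (\<Sum>\<alpha>\<in>mi_upto k. a \<alpha> * y \<alpha>)" for y
    by (simp add: riesz_def lookup f_def)
  ultimately show ?thesis
    using keys by (intro that[of p]) (auto simp: polys_upto_def lookup f_def)
qed

lemma moments_of_point_masses:
  fixes K :: "(real ^ 'n::finite) set"
  assumes "determining_set k K" and "strictly_K_positive k K y"
  shows "\<exists>z\<in>point_moments K. \<forall>\<alpha>\<in>mi_upto k. y \<alpha> = z \<alpha>"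
proof (rule ccontr)
  assume "\<not> ?thesis"
  then have outside: "\<exists>\<alpha>\<in>mi_upto k. z \<alpha> \<noteq> y \<alpha>" if "z \<in> point_moments K" for z
    using that by force
  have "mi_upto k \<noteq> ({} :: 'n multi_index set)"
    using outside[OF zero_in_point_moments] by blast
  then have "separates_cones (mi_upto k :: 'n multi_index set)"
    by (intro cone_separation finite_mi_upto)
  from separate_point_from_cone[OF this function_cone_point_moments zero_in_point_moments outside]
  obtain a where a: "\<exists>\<alpha>\<in>mi_upto k. a \<alpha> \<noteq> 0"
      "\<forall>z\<in>point_moments K. 0 \<le> (\<Sum>\<alpha>\<in>mi_upto k. a \<alpha> * z \<alpha>)"
      "(\<Sum>\<alpha>\<in>mi_upto k. a \<alpha> * y \<alpha>) \<le> 0"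
    by blast
  obtain p where p: "p \<in> polys_upto k"
      "\<And>\<alpha>. \<alpha> \<in> mi_upto k \<Longrightarrow> Poly_Mapping.lookup p \<alpha> = a \<alpha>"
      "\<And>x. mpoly_eval p x = (\<Sum>\<alpha>\<in>mi_upto k. a \<alpha> * mi_power x \<alpha>)"
      "\<And>y. riesz k y p = (\<Sum>\<alpha>\<in>mi_upto k. a \<alpha> * y \<alpha>)"
    using polynomial_with_coefficients[where a = a and k = k] by blast
  have "p \<noteq> 0" using a(1) p(2) by auto
  then have "\<not> (\<forall>x\<in>K. mpoly_eval p x = 0)"
    using assms(1) p(1) unfolding determining_set_def by blast
  moreover have "\<forall>x\<in>K. 0 \<le> mpoly_eval p x"
    using a(2) mi_power_in_point_moments by (auto simp: p(3))
  ultimately have "0 < riesz k y p"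
    using assms(2) p(1) unfolding strictly_K_positive_def by blast
  then show False using a(3) p(4) by simp
qed

theorem theorem1p3:
  fixes K :: "(real ^ 'n::finite) set"
    and k :: nat
    and y :: "'n multi_index \<Rightarrow> real"
  assumes "k \<ge> 1"
    and "closed K"
    and "determining_set k K"
    and "strictly_K_positive k K y"
  shows "\<exists>\<mu>. K_representing_measure k K y \<mu>"
proof -
  obtain z where "z \<in> point_moments K" "\<forall>\<alpha>\<in>mi_upto k. y \<alpha> = z \<alpha>"
    using moments_of_point_masses[OF assms(3,4)] by blast
  then show ?thesis
    by (intro K_representing_measure_point_masses[of z]) auto
qed

end
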